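(* Let $c=1$ and $d=2$. Then $\mathrm{Bad}_1\setminus\mathrm{Bad}_0\subset\mathbb{R}^2$ contains uncountably many elements.
   Context: $\mathbb{R}^2$ carries the standard Euclidean norm, $\mathrm{d}(x,\mathbb{Z}^2)$ is the distance from $x$ to $\mathbb{Z}^2$. For $\theta\in\mathbb{R}^2$, a positive integer $q$ is a best approximation denominator of $\theta$ if $\mathrm{d}(q\theta,\mathbb{Z}^2)<\mathrm{d}(u\theta,\mathbb{Z}^2)$ for all integers $1\le u<q$. These are ordered increasingly as $q_0=1<q_1<q_2<\cdots$, and $r_n=\mathrm{d}(q_n\theta,\mathbb{Z}^2)$; the sequence is infinite unless $\theta\in\mathbb{Q}^2$. For an integer $k\ge0$, $\mathrm{Bad}_k=\{\theta\in\mathbb{R}^2\setminus\mathbb{Q}^2:\ \inf_{n\in\mathbb{N}}q_{n+k}\,r_n^2>0\}$. *)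

theory Defs
  imports "HOL-Analysis.Analysis"
begin

definition int_points :: "(real ^ 2) set" where
  "int_points = {x. \<forall>i. x $ i \<in> \<int>}"

definition rat_points :: "(real ^ 2) set" where
  "rat_points = {x. \<forall>i. x $ i \<in> \<rat>}"

definition dist_int :: "real ^ 2 \<Rightarrow> real" where
  "dist_int x = infdist x int_points"

definition best_approx_denom :: "real ^ 2 \<Rightarrow> nat \<Rightarrow> bool" where
  "best_approx_denom \<theta> q \<longleftrightarrow>
     q \<ge> 1 \<and> (\<forall>u. 1 \<le> u \<and> u < q \<longrightarrow> dist_int (real q *\<^sub>R \<theta>) < dist_int (real u *\<^sub>R \<theta>))"

(* For rational points the set of best approximation denominators is finite and
   enumerate is unspecified beyond its cardinality; such points are excluded in Bad. *)
definition best_denom :: "real ^ 2 \<Rightarrow> nat \<Rightarrow> nat" where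
  "best_denom \<theta> n = enumerate {q. best_approx_denom \<theta> q} n"

definition best_dist :: "real ^ 2 \<Rightarrow> nat \<Rightarrow> real" where
  "best_dist \<theta> n = dist_int (real (best_denom \<theta> n) *\<^sub>R \<theta>)"

(* The infimum is over a nonempty set of reals bounded below by 0. *)
definition Bad :: "nat \<Rightarrow> (real ^ 2) set" where
  "Bad k = {\<theta>. \<theta> \<notin> rat_points \<and>
     (INF n. real (best_denom \<theta> (n + k)) * (best_dist \<theta> n)\<^sup>2) > 0}"

end

theory Submission
  imports Defs
begin

text \<open>
  For a rational point \<open>P\<close> of denominator \<open>Q\<close>, the group generated by \<open>\<int>\<^sup>2\<close> and \<open>P\<close> is a lattice of
  covolume \<open>1 / Q\<close>. If it is well rounded, choose in it a long vector \<open>\<omega>\<close> and move from \<open>P\<close> to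
  \<open>P' = P + \<omega> / Q'\<close> with \<open>Q' \<approx> (Q |\<omega>|)\<^sup>2\<close>. The lattice of \<open>P'\<close> is then again well rounded, with the
  same constants, and every \<open>\<theta>\<close> very close to \<open>P'\<close> has a jump of its best approximation denominators
  from about \<open>Q\<close> to about \<open>Q'\<close>, provided that no short vector of the first lattice is almost
  parallel to \<open>\<omega>\<close>. Since \<open>d(Q\<theta>, \<int>\<^sup>2)\<close> has size \<open>1 / \<surd>Q'\<close>, unbounded ratios \<open>Q' / Q\<close> exclude \<open>\<theta>\<close> from
  \<open>Bad\<^sub>0\<close>, while the uniform roundness keeps it in \<open>Bad\<^sub>1\<close>. Iterating gives nested balls, and as
  \<open>|P' - P|\<close> is arbitrarily small but nonzero, the \<open>n\<close>-th ball can avoid the \<open>n\<close>-th point of any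
  given sequence.
\<close>

section \<open>Exterior product in the plane and distance to the integer lattice\<close>

definition wedge :: "real ^ 2 \<Rightarrow> real ^ 2 \<Rightarrow> real" where
  "wedge x y = x $ 1 * y $ 2 - x $ 2 * y $ 1"

lemma wedge_add_left: "wedge (x + y) z = wedge x z + wedge y z"
  and wedge_add_right: "wedge x (y + z) = wedge x y + wedge x z"
  and wedge_diff_left: "wedge (x - y) z = wedge x z - wedge y z"
  and wedge_diff_right: "wedge x (y - z) = wedge x y - wedge x z"
  and wedge_scaleR_left: "wedge (r *\<^sub>R x) z = r * wedge x z"
  and wedge_scaleR_right: "wedge x (r *\<^sub>R z) = r * wedge x z"
  and wedge_minus_left: "wedge (- x) z = - wedge x z"
  and wedge_self: "wedge x x = 0"
  and wedge_commute: "wedge x y = - wedge y x"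
  by (simp_all add: wedge_def algebra_simps)

lemmas wedge_simps = wedge_add_left wedge_add_right wedge_diff_left wedge_diff_right
  wedge_scaleR_left wedge_scaleR_right wedge_minus_left wedge_self

text \<open>Lagrange's identity. It yields the Cauchy-Schwarz bound for \<open>wedge\<close>, and
  later bounds one basis vector through the covolume, the other vector and their inner
  product.\<close>

lemma wedge_inner_norm: "(wedge x y)\<^sup>2 + (x \<bullet> y)\<^sup>2 = (norm x)\<^sup>2 * (norm y)\<^sup>2"
  unfolding wedge_def power2_norm_eq_inner inner_vec_def sum_2
  by (simp add: power2_eq_square algebra_simps)

lemma abs_wedge_le: "\<bar>wedge x y\<bar> \<le> norm x * norm y"
proof -
  have "(wedge x y)\<^sup>2 \<le> (norm x * norm y)\<^sup>2"
    using wedge_inner_norm[of x y] zero_le_power2[of "x \<bullet> y"]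
    unfolding power_mult_distrib by linarith
  then show ?thesis
    by (metis abs_le_square_iff abs_of_nonneg norm_ge_zero zero_le_mult_iff)
qed

lemma int_points_add: "x \<in> int_points \<Longrightarrow> y \<in> int_points \<Longrightarrow> x + y \<in> int_points"
  and int_points_scaleR: "x \<in> int_points \<Longrightarrow> of_int k *\<^sub>R x \<in> int_points"
  and int_points_zero: "0 \<in> int_points"
  by (auto simp: int_points_def)

lemma dist_int_le: "z \<in> int_points \<Longrightarrow> dist_int x \<le> norm (x - z)"
  unfolding dist_int_def dist_norm[symmetric] by (rule infdist_le)

lemma dist_int_ge:
  assumes "\<And>z. z \<in> int_points \<Longrightarrow> c \<le> norm (x - z)"
  shows "c \<le> dist_int x"
proof -
  have "int_points \<noteq> {}" using int_points_zero by blast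
  then show ?thesis unfolding dist_int_def
    by (simp add: infdist_notempty dist_norm) (intro cINF_greatest assms; simp)
qed

lemma dist_int_nonneg: "0 \<le> dist_int x"
  by (simp add: dist_int_def infdist_nonneg)

section \<open>Reduced lattice bases at a rational point\<close>

text \<open>
  \<open>(Q, QP)\<close>, \<open>(p, a + pP)\<close> and \<open>(q, b + qP)\<close> form a basis of \<open>\<int> \<times> \<int>\<^sup>2\<close>; \<open>a\<close> and \<open>b\<close> are the images of the
  last two under the projection \<open>(u, z) \<mapsto> z - uP\<close> along the first, and they form a reduced basis
  of the lattice generated by \<open>\<int>\<^sup>2\<close> and \<open>P\<close>.
\<close>

definition reduced_frame ::
    "int \<Rightarrow> real ^ 2 \<Rightarrow> int \<Rightarrow> real ^ 2 \<Rightarrow> int \<Rightarrow> real ^ 2 \<Rightarrow> bool" where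
  "reduced_frame Q P p a q b \<longleftrightarrow>
     Q > 0 \<and> of_int Q *\<^sub>R P \<in> int_points \<and>
     a + of_int p *\<^sub>R P \<in> int_points \<and> b + of_int q *\<^sub>R P \<in> int_points \<and>
     (\<forall>u. \<forall>z\<in>int_points. \<exists>m k l. u = m * Q + k * p + l * q \<and>
        z - of_int u *\<^sub>R P = of_int k *\<^sub>R a + of_int l *\<^sub>R b) \<and>
     \<bar>wedge a b\<bar> = 1 / of_int Q \<and>
     norm a \<le> 2 / sqrt (of_int Q) \<and> norm b \<le> 2 / sqrt (of_int Q)"

lemma reduced_frame_origin: "reduced_frame 1 0 0 (axis 1 1) 0 (axis 2 1)"
proof -
  have "\<exists>k l. z = of_int k *\<^sub>R axis 1 1 + of_int l *\<^sub>R axis 2 1"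
    if z: "z \<in> int_points" for z :: "real ^ 2"
  proof -
    have "z $ 1 \<in> \<int>" "z $ 2 \<in> \<int>" using z by (auto simp: int_points_def)
    then obtain k l where "z $ 1 = of_int k" "z $ 2 = of_int l" by (auto elim!: Ints_cases)
    then have "z = of_int k *\<^sub>R axis 1 1 + of_int l *\<^sub>R axis 2 1"
      by (simp add: vec_eq_iff forall_2 axis_def)
    then show ?thesis by blast
  qed
  moreover have "wedge (axis 1 1) (axis 2 1) = 1" by (simp add: wedge_def axis_def)
  moreover have "axis i 1 \<in> int_points" for i :: 2 by (simp add: int_points_def axis_def)
  ultimately show ?thesis
    by (simp add: reduced_frame_def int_points_zero norm_axis_1)
qed

text \<open>Cramer's rule: \<open>wedge w b\<close> is \<open>k\<close> times
  \<open>wedge a b\<close>, whose absolute value is \<open>1 / Q\<close>, while \<open>b\<close> has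
  length at most \<open>2 / sqrt Q\<close>. In particular a nonzero lattice vector has length at
  least \<open>1 / (2 * sqrt Q)\<close>.\<close>

lemma reduced_frame_coeff_le:
  assumes "reduced_frame Q P p a q b" and w: "w = of_int k *\<^sub>R a + of_int l *\<^sub>R b"
  shows "\<bar>of_int k\<bar> \<le> 2 * sqrt (of_int Q) * norm w" "\<bar>of_int l\<bar> \<le> 2 * sqrt (of_int Q) * norm w"
proof -
  have Q: "Q > 0" and ab: "\<bar>wedge a b\<bar> = 1 / of_int Q"
    and na: "norm a \<le> 2 / sqrt (of_int Q)" and nb: "norm b \<le> 2 / sqrt (of_int Q)"
    using assms(1) by (auto simp: reduced_frame_def)
  have s: "of_int Q / sqrt (of_int Q) = sqrt (real_of_int Q)"
    using Q by (simp add: real_div_sqrt)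
  have bound: "\<bar>n\<bar> \<le> 2 * sqrt (of_int Q) * norm w"
    if "\<bar>wedge w c\<bar> = \<bar>n\<bar> / of_int Q" "norm c \<le> 2 / sqrt (of_int Q)" for n c
  proof -
    have "\<bar>n\<bar> / of_int Q \<le> norm w * (2 / sqrt (of_int Q))"
      using abs_wedge_le[of w c] that mult_left_mono[OF that(2) norm_ge_zero[of w]] by linarith
    then have "\<bar>n\<bar> \<le> norm w * (2 / sqrt (of_int Q)) * of_int Q"
      using Q by (simp add: field_simps)
    also have "\<dots> = 2 * (of_int Q / sqrt (of_int Q)) * norm w" by simp
    finally show ?thesis unfolding s .
  qed
  show "\<bar>of_int k\<bar> \<le> 2 * sqrt (of_int Q) * norm w"
    by (rule bound[OF _ nb]) (use ab in \<open>simp add: w wedge_simps abs_mult\<close>)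
  show "\<bar>of_int l\<bar> \<le> 2 * sqrt (of_int Q) * norm w"
    by (rule bound[OF _ na])
      (use ab in \<open>simp add: w wedge_simps abs_mult wedge_commute[of b a]\<close>)
qed

text \<open>As \<open>u\<close> is no multiple of \<open>Q\<close>, the lattice vector
  \<open>z - uP\<close> is nonzero and has length at least \<open>1 / (2 * sqrt Q)\<close>.
  Replacing \<open>P\<close> by \<open>\<theta>\<close> costs at most half of that.\<close>

lemma reduced_frame_dist_ge:
  assumes fr: "reduced_frame Q P p a q b"
    and near: "of_int Q * norm (\<theta> - P) \<le> 1 / (4 * sqrt (of_int Q))"
    and u: "1 \<le> u" "int u < Q"
  shows "1 / (4 * sqrt (of_int Q)) \<le> dist_int (real u *\<^sub>R \<theta>)"
proof (rule dist_int_ge)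
  fix z assume "z \<in> int_points"
  have Q: "Q > 0" using fr by (simp add: reduced_frame_def)
  obtain m k l where m: "int u = m * Q + k * p + l * q"
    and w: "z - real u *\<^sub>R P = of_int k *\<^sub>R a + of_int l *\<^sub>R b"
    using fr \<open>z \<in> int_points\<close> unfolding reduced_frame_def by (metis of_int_of_nat_eq)
  have "k \<noteq> 0 \<or> l \<noteq> 0"
  proof (rule ccontr)
    assume "\<not> ?thesis"
    then have "int u = m * Q" using m by simp
    then have "Q dvd int u" by simp
    then show False using u zdvd_imp_le by fastforce
  qed
  then have "1 \<le> \<bar>real_of_int k\<bar> \<or> 1 \<le> \<bar>real_of_int l\<bar>" by linarith
  then have "1 \<le> 2 * sqrt (of_int Q) * norm (z - real u *\<^sub>R P)"
    using reduced_frame_coeff_le[OF fr w] by linarith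
  then have 1: "2 * (1 / (4 * sqrt (of_int Q))) \<le> norm (z - real u *\<^sub>R P)"
    using Q by (simp add: field_simps)
  have "real u * norm (\<theta> - P) \<le> of_int Q * norm (\<theta> - P)"
    using u by (intro mult_right_mono) auto
  then have 2: "norm (real u *\<^sub>R (\<theta> - P)) \<le> 1 / (4 * sqrt (of_int Q))"
    using near by simp
  have "norm (z - real u *\<^sub>R P) = norm (real u *\<^sub>R (\<theta> - P) - (real u *\<^sub>R \<theta> - z))"
    by (simp add: algebra_simps)
  also have "\<dots> \<le> norm (real u *\<^sub>R (\<theta> - P)) + norm (real u *\<^sub>R \<theta> - z)"
    by (rule norm_triangle_ineq4)
  finally show "1 / (4 * sqrt (of_int Q)) \<le> norm (real u *\<^sub>R \<theta> - z)"
    using 1 2 by linarith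
qed

section \<open>Passing to the next rational point\<close>

text \<open>
  The new basis consists of lifts of \<open>\<omega>\<close>, of \<open>0\<close> and of \<open>ta + b\<close>. The integer \<open>M\<close> puts \<open>Q'\<close> within \<open>Q\<close>
  of \<open>(Q |\<omega>|)\<^sup>2\<close>, which balances the length of \<open>a'\<close> against the covolume \<open>1 / Q'\<close>; the integer \<open>j\<close>
  performs one step of Gauss reduction.
\<close>

lemma reduced_frame_extend:
  fixes t :: nat
  assumes fr: "reduced_frame Q P p a q b" and t: "10 \<le> t"
  defines "\<omega> \<equiv> of_int (2 * int t + 1) *\<^sub>R a + 2 *\<^sub>R b"
  obtains Q' p' a' q' b' where
    "reduced_frame Q' (P + (1 / of_int Q') *\<^sub>R \<omega>) p' a' q' b'"
    "(of_int Q * norm \<omega>)\<^sup>2 \<le> of_int Q'"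
    "of_int Q * (2 * real t + 1)\<^sup>2 \<le> 4 * real_of_int Q'"
proof -
  have Q: "Q > 0" and Pi: "of_int Q *\<^sub>R P \<in> int_points"
    and ai: "a + of_int p *\<^sub>R P \<in> int_points" and bi: "b + of_int q *\<^sub>R P \<in> int_points"
    and ab: "\<bar>wedge a b\<bar> = 1 / of_int Q"
    using fr by (auto simp: reduced_frame_def)
  define X where "X = of_int Q * norm \<omega>"
  have X: "sqrt (of_int Q) * (2 * real t + 1) \<le> 2 * X"
  proof -
    have "\<bar>of_int (2 * int t + 1)\<bar> \<le> 2 * sqrt (of_int Q) * norm \<omega>"
      by (rule reduced_frame_coeff_le(1)[OF fr, of _ _ 2]) (simp add: \<omega>_def)
    then have "sqrt (of_int Q) * (2 * real t + 1) \<le> sqrt (of_int Q) * (2 * sqrt (of_int Q) * norm \<omega>)"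
      using Q by (intro mult_left_mono) auto
    also have "\<dots> = 2 * (sqrt (of_int Q) * sqrt (of_int Q)) * norm \<omega>" by (simp only: ac_simps)
    finally show ?thesis using Q by (simp add: X_def)
  qed
  have X2: "of_int Q * (2 * real t + 1)\<^sup>2 \<le> 4 * X\<^sup>2"
  proof -
    have "(sqrt (of_int Q) * (2 * real t + 1))\<^sup>2 \<le> (2 * X)\<^sup>2"
      using X Q by (intro power_mono) auto
    then show ?thesis using Q by (simp add: power_mult_distrib)
  qed
  \<comment> \<open>The rounding in \<open>M\<close> raises \<open>Q'\<close> above
    \<open>X\<^sup>2\<close> by less than \<open>Q\<close>, so this bound keeps \<open>Q'\<close>
    below \<open>2 * X\<^sup>2\<close>.\<close>
  have X3: "of_int Q \<le> X\<^sup>2"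
  proof -
    have "4 \<le> (2 * real t + 1)\<^sup>2" using power_mono[of 2 "2 * real t + 1" 2] t by simp
    then have "of_int Q * 4 \<le> of_int Q * (2 * real t + 1)\<^sup>2" using Q by (intro mult_left_mono) auto
    then show ?thesis using X2 by linarith
  qed
  have Xpos: "X > 0" using X Q by (smt (verit) mult_pos_pos of_int_0_less_iff of_nat_0_le_iff real_sqrt_gt_zero)
  define g where "g = (2 * int t + 1) * p + 2 * q"
  define M where "M = \<lceil>(X\<^sup>2 - of_int g) / of_int Q\<rceil>"
  define Q' where "Q' = g + M * Q"
  have Q'_ge: "X\<^sup>2 \<le> of_int Q'"
  proof -
    have "(X\<^sup>2 - of_int g) / of_int Q \<le> of_int M" unfolding M_def by (rule le_of_int_ceiling)
    then show ?thesis using Q by (simp add: Q'_def pos_divide_le_eq)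
  qed
  have "of_int M < (X\<^sup>2 - of_int g) / of_int Q + 1" unfolding M_def by linarith
  then have "of_int Q' < X\<^sup>2 + of_int Q"
    using Q by (simp add: Q'_def field_simps)
  then have Q'_le: "of_int Q' \<le> 2 * X\<^sup>2" using X3 by linarith
  have Q'pos: "Q' > 0" using Q'_ge Xpos
    by (metis of_int_0_less_iff order_less_le_trans zero_less_power)
  define P' where "P' = P + (1 / of_int Q') *\<^sub>R \<omega>"
  \<comment> \<open>\<open>a'\<close> and \<open>c\<close> are the projections along
    \<open>(Q', Q'P')\<close> of the old lifts of \<open>0\<close> and of \<open>ta + b\<close>,
    with first coordinates \<open>Q\<close> and \<open>t * p + q\<close>.\<close>
  define a' where "a' = - (of_int Q / of_int Q') *\<^sub>R \<omega>"
  define c where "c = real t *\<^sub>R a + b - (of_int (int t * p + q) / of_int Q') *\<^sub>R \<omega>"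
  define j where "j = - round ((c \<bullet> a') / (norm a')\<^sup>2)"
  define b' where "b' = c + of_int j *\<^sub>R a'"
  define q' where "q' = int t * p + q + j * Q"
  have na': "norm a' = X / of_int Q'" using Q Q'pos by (simp add: a'_def X_def)
  have na'pos: "norm a' > 0" using na' Xpos Q'pos by simp
  have wa: "wedge a' b' = - (of_int Q / of_int Q') * wedge a b"
  proof -
    \<comment> \<open>The matrix with rows \<open>(2t + 1, 2)\<close> and \<open>(t, 1)\<close> has
      determinant 1, so \<open>\<omega>\<close> and \<open>ta + b\<close> again form a basis of the
      old lattice.\<close>
    have "wedge \<omega> (real t *\<^sub>R a + b) = wedge a b"
      unfolding \<omega>_def by (simp add: wedge_simps wedge_commute[of b a] algebra_simps)
    then show ?thesis
      unfolding b'_def c_def a'_def by (simp add: wedge_simps flip: wedge_add_right)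
  qed
  have wab: "\<bar>wedge a' b'\<bar> = 1 / of_int Q'"
    using wa ab Q Q'pos by (simp add: abs_mult)
  have inner: "\<bar>a' \<bullet> b'\<bar> \<le> (norm a')\<^sup>2 / 2"
  proof -
    let ?r = "(c \<bullet> a') / (norm a')\<^sup>2"
    have "a' \<bullet> b' = (norm a')\<^sup>2 * (?r - of_int (round ?r))"
      using na'pos by (simp add: b'_def j_def inner_add_right inner_diff_right inner_commute power2_norm_eq_inner field_simps)
    moreover have "\<bar>?r - of_int (round ?r)\<bar> \<le> 1 / 2"
      using of_int_round_abs_le[of ?r] by (simp add: abs_minus_commute)
    ultimately show ?thesis
      using mult_left_mono[of "\<bar>?r - of_int (round ?r)\<bar>" "1/2" "(norm a')\<^sup>2"] by (simp add: abs_mult)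
  qed
  have na'2: "(norm a')\<^sup>2 \<le> 1 / of_int Q'"
    using Q'_ge Q'pos by (simp add: na' power_divide power2_eq_square field_simps)
  \<comment> \<open>Lagrange's identity divided by \<open>(norm a')\<^sup>2\<close>: the wedge term
    becomes \<open>1 / X\<^sup>2\<close>, at most \<open>2 / Q'\<close>, and Gauss reduction bounds
    the inner product term by \<open>(norm a')\<^sup>2 / 4\<close>.\<close>
  have nb'2: "(norm b')\<^sup>2 \<le> 4 / of_int Q'"
  proof -
    have i2: "(a' \<bullet> b')\<^sup>2 \<le> ((norm a')\<^sup>2 / 2)\<^sup>2"
      using inner by (rule power2_le_iff_abs_le[THEN iffD2, rotated]) simp
    have w2: "(wedge a' b')\<^sup>2 = 1 / (of_int Q')\<^sup>2"
      using wab by (metis power2_abs power_one_over)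
    have "(norm a')\<^sup>2 * (norm b')\<^sup>2 \<le> 1 / (of_int Q')\<^sup>2 + ((norm a')\<^sup>2 / 2)\<^sup>2"
      using wedge_inner_norm[of a' b'] i2 w2 by linarith
    also have "\<dots> = (norm a')\<^sup>2 * (1 / X\<^sup>2 + (norm a')\<^sup>2 / 4)"
      using Xpos Q'pos by (simp add: na' field_simps power2_eq_square)
    finally have "(norm b')\<^sup>2 \<le> 1 / X\<^sup>2 + (norm a')\<^sup>2 / 4"
      using na'pos by (metis mult_le_cancel_left_pos zero_less_power)
    moreover have "1 / X\<^sup>2 \<le> 2 / of_int Q'"
      using Q'_le Xpos Q'pos by (simp add: field_simps)
    moreover have "2 / of_int Q' = 2 * (1 / real_of_int Q')" "4 / of_int Q' = 4 * (1 / real_of_int Q')"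
      "0 < 1 / real_of_int Q'" using Q'pos by simp_all
    ultimately show ?thesis using na'2 by linarith
  qed
  have sq: "norm y \<le> 2 / sqrt (of_int Q')" if "(norm y)\<^sup>2 \<le> 4 / of_int Q'" for y :: "real ^ 2"
    using real_sqrt_le_mono[OF that] by (simp add: real_sqrt_divide)
  have nab: "norm a' \<le> 2 / sqrt (of_int Q')" "norm b' \<le> 2 / sqrt (of_int Q')"
  proof -
    have "1 / of_int Q' \<le> 4 / real_of_int Q'" using Q'pos by (simp add: field_simps)
    then show "norm a' \<le> 2 / sqrt (of_int Q')" using na'2 by (intro sq) linarith
    show "norm b' \<le> 2 / sqrt (of_int Q')" using nb'2 by (rule sq)
  qed
  have QP': "of_int Q' *\<^sub>R P' = of_int Q' *\<^sub>R P + \<omega>"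
    using Q'pos by (simp add: P'_def scaleR_add_right)
  have "of_int Q' *\<^sub>R P' = of_int (2 * int t + 1) *\<^sub>R (a + of_int p *\<^sub>R P)
      + of_int 2 *\<^sub>R (b + of_int q *\<^sub>R P) + of_int M *\<^sub>R (of_int Q *\<^sub>R P)"
    unfolding QP' by (simp add: Q'_def g_def \<omega>_def algebra_simps)
  then have 1: "of_int Q' *\<^sub>R P' \<in> int_points"
    using ai bi Pi by (metis int_points_add int_points_scaleR)
  have "a' + of_int Q *\<^sub>R P' = of_int Q *\<^sub>R P"
    by (simp add: a'_def P'_def algebra_simps)
  then have 2: "a' + of_int Q *\<^sub>R P' \<in> int_points" using Pi by simp
  have cP: "b' + of_int q' *\<^sub>R P' = of_int (int t) *\<^sub>R (a + of_int p *\<^sub>R P)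
      + (b + of_int q *\<^sub>R P) + of_int j *\<^sub>R (of_int Q *\<^sub>R P)"
    by (simp add: b'_def c_def q'_def P'_def a'_def algebra_simps add_divide_distrib)
  then have 3: "b' + of_int q' *\<^sub>R P' \<in> int_points"
    using ai bi Pi by (metis int_points_add int_points_scaleR)
  have 4: "\<exists>m k l. u = m * Q' + k * Q + l * q' \<and>
      z - of_int u *\<^sub>R P' = of_int k *\<^sub>R a' + of_int l *\<^sub>R b'"
    if z: "z \<in> int_points" for u z
  proof -
    obtain m k l where u: "u = m * Q + k * p + l * q"
      and w: "z - of_int u *\<^sub>R P = of_int k *\<^sub>R a + of_int l *\<^sub>R b"
      using fr z unfolding reduced_frame_def by metis
    \<comment> \<open>\<open>m'\<close> and \<open>l'\<close> are the coordinates in the basis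
      \<open>\<omega>\<close>, \<open>ta + b\<close>, found by inverting the matrix of determinant
      1; \<open>k'\<close> is then forced by the equation for \<open>u\<close>.\<close>
    define m' where "m' = k - l * int t"
    define l' where "l' = l * (1 + 2 * int t) - 2 * k"
    define k' where "k' = m - k * (M - 2 * j) + l * (int t * (M - 2 * j) - j)"
    have u': "u = m' * Q' + k' * Q + l' * q'"
      unfolding u m'_def l'_def k'_def Q'_def q'_def g_def by (simp add: algebra_simps)
    have kl: "of_int k *\<^sub>R a + of_int l *\<^sub>R b
        = of_int m' *\<^sub>R \<omega> + of_int l' *\<^sub>R (real t *\<^sub>R a + b)"
      unfolding m'_def l'_def \<omega>_def by (simp add: algebra_simps)
    have tab: "real t *\<^sub>R a + b = b' + (of_int q' / of_int Q') *\<^sub>R \<omega>"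
      by (simp add: b'_def c_def a'_def q'_def algebra_simps add_divide_distrib)
    have "of_int k *\<^sub>R a + of_int l *\<^sub>R b - (of_int u / of_int Q') *\<^sub>R \<omega>
        = (of_int m' - of_int u / of_int Q' + of_int l' * of_int q' / of_int Q') *\<^sub>R \<omega> + of_int l' *\<^sub>R b'"
      unfolding kl tab by (simp add: algebra_simps)
    also have "real_of_int m' - of_int u / of_int Q' + of_int l' * of_int q' / of_int Q'
        = - (of_int k' * of_int Q / of_int Q')"
      using Q'pos by (simp add: u' field_simps)
    finally have "z - of_int u *\<^sub>R P' = of_int k' *\<^sub>R a' + of_int l' *\<^sub>R b'"
      using w by (simp add: P'_def a'_def algebra_simps)
    then show ?thesis using u' by blast
  qed
  have "reduced_frame Q' P' Q a' q' b'"
    unfolding reduced_frame_def using Q'pos 1 2 3 4 wab nab by blast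
  moreover have "of_int Q * (2 * real t + 1)\<^sup>2 \<le> 4 * real_of_int Q'"
    using X2 Q'_ge by linarith
  ultimately show ?thesis using that Q'_ge unfolding P'_def X_def by blast
qed

section \<open>Lower bound for denominators that improve on the current one\<close>

text \<open>
  A denominator \<open>u\<close> violating the conclusion gives a lattice vector \<open>w\<close> with \<open>|w \<and> \<omega>| < 2 / Q\<close> that is
  short compared with \<open>\<omega>\<close>. The coordinates of \<open>w\<close> satisfy \<open>|2k - (2t + 1)l| < 2\<close>, which forces \<open>|k| \<ge> t\<close>,
  hence \<open>w\<close> has length comparable to \<open>\<omega>\<close>.
\<close>

lemma reduced_frame_gap:
  fixes t :: nat
  assumes fr: "reduced_frame Q P p a q b" and t: "10 \<le> t"
    and \<omega>: "\<omega> = of_int (2 * int t + 1) *\<^sub>R a + 2 *\<^sub>R b"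
    and Q'1: "(of_int Q * norm \<omega>)\<^sup>2 \<le> of_int Q'"
    and Q'2: "44 * Q \<le> Q'"
    and near1: "of_int Q' * norm (\<theta> - (P + (1 / of_int Q') *\<^sub>R \<omega>)) \<le> norm \<omega> / 10"
    and near2: "of_int Q' * norm (\<theta> - (P + (1 / of_int Q') *\<^sub>R \<omega>)) * (of_int Q * norm \<omega>) \<le> 1 / 5"
    and u: "1 \<le> u" "dist_int (real u *\<^sub>R \<theta>) < dist_int (of_int Q *\<^sub>R \<theta>)"
  shows "of_int Q' / 44 \<le> real u"
proof (rule ccontr)
  assume "\<not> ?thesis"
  then have u44: "real u < of_int Q' / 44" by simp
  have Q: "Q > 0" and Pi: "of_int Q *\<^sub>R P \<in> int_points" and ab: "\<bar>wedge a b\<bar> = 1 / of_int Q"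
    and na: "norm a \<le> 2 / sqrt (of_int Q)" and nb: "norm b \<le> 2 / sqrt (of_int Q)"
    using fr by (auto simp: reduced_frame_def)
  have Q': "Q' > 0" using Q Q'2 by linarith
  define \<delta> where "\<delta> = \<theta> - P"
  define \<eta> where "\<eta> = of_int Q' *\<^sub>R \<theta> - of_int Q' *\<^sub>R P - \<omega>"
  have \<eta>: "norm \<eta> = of_int Q' * norm (\<theta> - (P + (1 / of_int Q') *\<^sub>R \<omega>))"
  proof -
    have "\<eta> = of_int Q' *\<^sub>R (\<theta> - (P + (1 / of_int Q') *\<^sub>R \<omega>))"
      using Q' by (simp add: \<eta>_def algebra_simps)
    then show ?thesis using Q' by simp
  qed
  have \<eta>1: "norm \<eta> \<le> norm \<omega> / 10" and \<eta>2: "norm \<eta> * (of_int Q * norm \<omega>) \<le> 1 / 5"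
    using near1 near2 unfolding \<eta> by auto
  have \<delta>\<omega>: "of_int Q' *\<^sub>R \<delta> = \<omega> + \<eta>" by (simp add: \<delta>_def \<eta>_def algebra_simps)
  then have "of_int Q' * norm \<delta> = norm (\<omega> + \<eta>)"
    using Q' by (metis abs_of_pos norm_scaleR of_int_0_less_iff)
  then have n\<delta>: "of_int Q' * norm \<delta> \<le> 11 / 10 * norm \<omega>"
    using norm_triangle_ineq[of \<omega> \<eta>] \<eta>1 by linarith
  have "dist_int (of_int Q *\<^sub>R \<theta>) \<le> norm (of_int Q *\<^sub>R \<theta> - of_int Q *\<^sub>R P)"
    by (rule dist_int_le[OF Pi])
  also have "\<dots> = of_int Q * norm \<delta>"
    using Q by (simp add: \<delta>_def flip: scaleR_diff_right)
  finally have "\<not> of_int Q * norm \<delta> \<le> dist_int (real u *\<^sub>R \<theta>)" using u by linarith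
  then obtain z where z: "z \<in> int_points" and h: "norm (real u *\<^sub>R \<theta> - z) < of_int Q * norm \<delta>"
    using dist_int_ge[of "of_int Q * norm \<delta>" "real u *\<^sub>R \<theta>"] by (meson not_le)
  obtain m k l where m: "int u = m * Q + k * p + l * q"
    and w0: "z - real u *\<^sub>R P = of_int k *\<^sub>R a + of_int l *\<^sub>R b"
    using fr z unfolding reduced_frame_def by (metis of_int_of_nat_eq)
  define w where "w = z - real u *\<^sub>R P"
  have w: "w = of_int k *\<^sub>R a + of_int l *\<^sub>R b" using w0 by (simp add: w_def)
  have h': "norm (real u *\<^sub>R \<delta> - w) < of_int Q * norm \<delta>"
    using h by (simp add: w_def \<delta>_def algebra_simps)
  have kl: "k \<noteq> 0 \<or> l \<noteq> 0"
  proof (rule ccontr)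
    assume *: "\<not> ?thesis"
    then have "Q dvd int u" using m by simp
    then have "Q \<le> int u" using u zdvd_imp_le by fastforce
    then have "of_int Q * norm \<delta> \<le> real u * norm \<delta>" by (intro mult_right_mono) auto
    moreover have "w = 0" using * w by simp
    ultimately show False using h' by simp
  qed
  \<comment> \<open>Both \<open>u\<close> and \<open>Q\<close> are at most \<open>Q' / 44\<close>,
    and \<open>1/22 * 11/10 = 1/20\<close>.\<close>
  have nw: "norm w \<le> norm \<omega> / 20"
  proof -
    have "norm w = norm (real u *\<^sub>R \<delta> - (real u *\<^sub>R \<delta> - w))" by simp
    also have "\<dots> \<le> norm (real u *\<^sub>R \<delta>) + norm (real u *\<^sub>R \<delta> - w)" by (rule norm_triangle_ineq4)
    also have "\<dots> \<le> (real u + of_int Q) * norm \<delta>" using h' by (simp add: algebra_simps)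
    also have "\<dots> \<le> (of_int Q' / 22) * norm \<delta>"
      using u44 Q'2 by (intro mult_right_mono norm_ge_zero) linarith
    also have "\<dots> \<le> norm \<omega> / 20" using n\<delta> by simp
    finally show ?thesis .
  qed
  \<comment> \<open>Since \<open>w\<close> is within \<open>Q * norm \<delta>\<close> of a multiple
    of \<open>\<delta>\<close>, its wedge with \<open>\<delta>\<close> is small. Writing
    \<open>\<omega>\<close> as \<open>Q'\<delta> - \<eta>\<close> gives, after multiplication by
    \<open>Q\<close>, at most 121/100 from \<open>Q'\<delta>\<close> and 1/100 from
    \<open>\<eta>\<close>.\<close>
  have "\<bar>wedge w \<omega>\<bar> < 2 / of_int Q"
  proof -
    have "wedge w \<delta> = - wedge (real u *\<^sub>R \<delta> - w) \<delta>" by (simp add: wedge_simps)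
    then have "\<bar>wedge w \<delta>\<bar> \<le> norm (real u *\<^sub>R \<delta> - w) * norm \<delta>"
      using abs_wedge_le[of "real u *\<^sub>R \<delta> - w" \<delta>] by simp
    also have "\<dots> \<le> of_int Q * norm \<delta> * norm \<delta>" using h' by (intro mult_right_mono) auto
    finally have "of_int Q' * \<bar>wedge w \<delta>\<bar> \<le> of_int Q' * (of_int Q * norm \<delta> * norm \<delta>)"
      using Q' by (intro mult_left_mono) auto
    then have "of_int Q' * (of_int Q' * \<bar>wedge w \<delta>\<bar>) \<le> of_int Q * (of_int Q' * norm \<delta>)\<^sup>2"
      using Q' by (simp add: power2_eq_square mult.left_commute mult.assoc)
    also have "\<dots> \<le> of_int Q * (11 / 10 * norm \<omega>)\<^sup>2"
      using n\<delta> Q Q' by (intro mult_left_mono power_mono) auto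
    finally have "of_int Q * (of_int Q' * (of_int Q' * \<bar>wedge w \<delta>\<bar>))
        \<le> of_int Q * (of_int Q * (11 / 10 * norm \<omega>)\<^sup>2)"
      using Q by (intro mult_left_mono) auto
    also have "\<dots> = 121 / 100 * (of_int Q * norm \<omega>)\<^sup>2" by (simp add: power2_eq_square)
    also have "\<dots> \<le> 121 / 100 * of_int Q'" using Q'1 by simp
    finally have "of_int Q' * (of_int Q * (of_int Q' * \<bar>wedge w \<delta>\<bar>)) \<le> of_int Q' * (121 / 100)"
      by (simp add: ac_simps)
    then have 1: "of_int Q * \<bar>wedge w (of_int Q' *\<^sub>R \<delta>)\<bar> \<le> 121 / 100"
      using Q' by (simp add: wedge_simps abs_mult)
    have "\<bar>wedge w \<eta>\<bar> \<le> norm \<omega> / 20 * norm \<eta>"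
      using abs_wedge_le[of w \<eta>] mult_right_mono[OF nw norm_ge_zero[of \<eta>]] by linarith
    then have "of_int Q * \<bar>wedge w \<eta>\<bar> \<le> of_int Q * (norm \<omega> / 20 * norm \<eta>)"
      using Q by (intro mult_left_mono) auto
    also have "\<dots> = (norm \<eta> * (of_int Q * norm \<omega>)) / 20" by simp
    finally have 2: "of_int Q * \<bar>wedge w \<eta>\<bar> \<le> 1 / 100" using \<eta>2 by linarith
    have "\<bar>wedge w \<omega>\<bar> \<le> \<bar>wedge w (of_int Q' *\<^sub>R \<delta>)\<bar> + \<bar>wedge w \<eta>\<bar>"
      unfolding \<delta>\<omega> wedge_add_right by linarith
    then have "of_int Q * \<bar>wedge w \<omega>\<bar> \<le> of_int Q * (\<bar>wedge w (of_int Q' *\<^sub>R \<delta>)\<bar> + \<bar>wedge w \<eta>\<bar>)"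
      using Q by (intro mult_left_mono) auto
    then have "of_int Q * \<bar>wedge w \<omega>\<bar> < 2" using 1 2 by (simp add: distrib_left)
    then show ?thesis using Q by (simp add: field_simps)
  qed
  moreover have "wedge w \<omega> = of_int (2 * k - (2 * int t + 1) * l) * wedge a b"
    unfolding w \<omega> by (simp add: wedge_simps wedge_commute[of b a] algebra_simps)
  ultimately have "\<bar>of_int (2 * k - (2 * int t + 1) * l)\<bar> < (2::real)"
    using ab Q by (simp add: abs_mult divide_less_cancel)
  then have small: "\<bar>2 * k - (2 * int t + 1) * l\<bar> < 2" by linarith
  have "l \<noteq> 0" using small kl by auto
  then have "(2 * int t + 1) * 1 \<le> (2 * int t + 1) * \<bar>l\<bar>" by (intro mult_left_mono) auto
  also have "\<dots> = \<bar>(2 * int t + 1) * l\<bar>" by (simp add: abs_mult)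
  finally have large: "2 * int t + 1 \<le> \<bar>(2 * int t + 1) * l\<bar>" by simp
  \<comment> \<open>\<open>2k\<close> is even and exceeds \<open>2t - 1\<close> in absolute value,
    hence is at least \<open>2t\<close> in absolute value.\<close>
  have "int t \<le> \<bar>k\<bar>" if "2 * int t + 1 \<le> \<bar>y\<bar>" "\<bar>2 * k - y\<bar> < 2" for y
    using that by linarith
  from this[OF large small] have "int t \<le> \<bar>k\<bar>" .
  then have "real t \<le> \<bar>of_int k\<bar>" by linarith
  also have "\<dots> \<le> 2 * sqrt (of_int Q) * norm w" by (rule reduced_frame_coeff_le(1)[OF fr w])
  also have "\<dots> \<le> 2 * sqrt (of_int Q) * (norm \<omega> / 20)"
    using nw Q by (intro mult_left_mono) auto
  finally have t1: "10 * real t \<le> sqrt (of_int Q) * norm \<omega>" by (simp add: mult.commute)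
  \<comment> \<open>The upper bound \<open>4t + 6\<close> coming from the reduced basis contradicts
    the lower bound \<open>10t\<close> in \<open>t1\<close>.\<close>
  have "norm \<omega> \<le> (2 * real t + 1) * norm a + 2 * norm b"
    unfolding \<omega> using norm_triangle_ineq[of "of_int (2 * int t + 1) *\<^sub>R a" "2 *\<^sub>R b"] by simp
  also have "\<dots> \<le> (2 * real t + 1) * (2 / sqrt (of_int Q)) + 2 * (2 / sqrt (of_int Q))"
    using na nb by (intro add_mono mult_left_mono) auto
  also have "\<dots> = (4 * real t + 6) / sqrt (of_int Q)" using Q by (simp add: field_simps)
  finally have "sqrt (of_int Q) * norm \<omega> \<le> 4 * real t + 6" using Q by (simp add: field_simps)
  then show False using t1 t by simp
qed

section \<open>Excursions and the nested balls\<close>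

definition reduced_denom :: "int \<Rightarrow> real ^ 2 \<Rightarrow> bool" where
  "reduced_denom Q P \<longleftrightarrow> (\<exists>p a q b. reduced_frame Q P p a q b)"

text \<open>The first two clauses serve the uniform lower bound behind \<open>Bad 1\<close>; the
  third, with \<open>\<epsilon>\<close> tending to 0, refutes \<open>Bad 0\<close>. No best
  approximations occur, so \<open>Q\<close> need not itself be a best approximation
  denominator.\<close>

definition excursion :: "int \<Rightarrow> int \<Rightarrow> real \<Rightarrow> real ^ 2 \<Rightarrow> bool" where
  "excursion Q Q' \<epsilon> \<theta> \<longleftrightarrow>
     (\<forall>u::nat. 1 \<le> u \<longrightarrow> int u < Q' \<longrightarrow> 1 / (4 * sqrt (of_int Q')) \<le> dist_int (real u *\<^sub>R \<theta>)) \<and>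
     (\<forall>u::nat. 1 \<le> u \<longrightarrow> dist_int (real u *\<^sub>R \<theta>) < dist_int (of_int Q *\<^sub>R \<theta>) \<longrightarrow>
        of_int Q' / 44 \<le> real u) \<and>
     of_int Q * (dist_int (of_int Q *\<^sub>R \<theta>))\<^sup>2 \<le> \<epsilon>"

text \<open>A large \<open>t\<close> makes both \<open>Q' / Q\<close> large and \<open>P'\<close>
  close to \<open>P\<close>. A small enough radius then secures the hypotheses of
  \<open>reduced_frame_dist_ge\<close> and \<open>reduced_frame_gap\<close> on the whole new
  ball.\<close>

lemma excursion_step:
  assumes "reduced_denom Q P" and \<rho>: "\<rho> > 0" and \<epsilon>: "\<epsilon> > 0"
  shows "\<exists>Q' P' \<rho>'. reduced_denom Q' P' \<and> \<rho>' > 0 \<and> Q < Q' \<and> cball P' \<rho>' \<subseteq> cball P \<rho> \<and>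
    x \<notin> cball P' \<rho>' \<and> (\<forall>\<theta>\<in>cball P' \<rho>'. excursion Q Q' \<epsilon> \<theta>)"
proof -
  obtain p a q b where fr: "reduced_frame Q P p a q b"
    using assms(1) by (auto simp: reduced_denom_def)
  have Q: "Q > 0" and Pi: "of_int Q *\<^sub>R P \<in> int_points"
    using fr by (auto simp: reduced_frame_def)
  \<comment> \<open>The entry 1 for \<open>x = P\<close> is a harmless default: in that case
    \<open>x\<close> is excluded because \<open>P'\<close> differs from \<open>P\<close>.\<close>
  define \<kappa> where "\<kappa> = Min {\<rho>, \<epsilon>, if x = P then 1 else dist x P, 1}"
  have \<kappa>: "\<kappa> > 0" "\<kappa> \<le> \<rho>" "\<kappa> \<le> \<epsilon>" "x \<noteq> P \<Longrightarrow> \<kappa> \<le> dist x P" "\<kappa> \<le> 1"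
    using \<rho> \<epsilon> by (auto simp: \<kappa>_def)
  obtain t :: nat where t: "10 / \<kappa> < real t" using reals_Archimedean2 by blast
  have "10 \<le> 10 / \<kappa>" using \<kappa> by (simp add: field_simps)
  then have t10: "10 \<le> t" using t by linarith
  have t\<kappa>: "10 < \<kappa> * real t" using t \<kappa>(1) by (simp add: field_simps)
  define \<omega> where "\<omega> = of_int (2 * int t + 1) *\<^sub>R a + 2 *\<^sub>R b"
  obtain Q' p' a' q' b' where fr': "reduced_frame Q' (P + (1 / of_int Q') *\<^sub>R \<omega>) p' a' q' b'"
    and Q'1: "(of_int Q * norm \<omega>)\<^sup>2 \<le> of_int Q'"
    and Q'2: "of_int Q * (2 * real t + 1)\<^sup>2 \<le> 4 * real_of_int Q'"
    using reduced_frame_extend[OF fr t10] unfolding \<omega>_def by blast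
  define P' where "P' = P + (1 / of_int Q') *\<^sub>R \<omega>"
  have Q': "Q' > 0" using fr' by (auto simp: reduced_frame_def)
  have Q'44: "44 * Q \<le> Q'"
  proof -
    have "176 \<le> (2 * real t + 1)\<^sup>2" using power_mono[of 21 "2 * real t + 1" 2] t10 by simp
    then have "of_int Q * 176 \<le> of_int Q * (2 * real t + 1)\<^sup>2" using Q by (intro mult_left_mono) auto
    then have "real_of_int (44 * Q) \<le> real_of_int Q'" using Q'2 by simp
    then show ?thesis by linarith
  qed
  have \<omega>0: "norm \<omega> > 0"
  proof -
    have "\<bar>of_int (2 * int t + 1)\<bar> \<le> 2 * sqrt (of_int Q) * norm \<omega>"
      by (rule reduced_frame_coeff_le(1)[OF fr, of _ _ 2]) (simp add: \<omega>_def)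
    then show ?thesis by (cases "\<omega> = 0") auto
  qed
  have dPP: "dist P P' = norm \<omega> / of_int Q'" using Q' by (simp add: P'_def dist_norm)
  have dpos: "dist P P' > 0" using \<omega>0 Q' dPP by simp
  have tsq: "(real t)\<^sup>2 \<le> real_of_int Q'"
  proof -
    have "1 * (2 * real t)\<^sup>2 \<le> of_int Q * (2 * real t + 1)\<^sup>2"
      using Q by (intro mult_mono power_mono) auto
    then show ?thesis using Q'2 by simp
  qed
  \<comment> \<open>Both \<open>norm \<omega>\<close> and \<open>t\<close> are at most
    \<open>sqrt Q'\<close>.\<close>
  have dle: "dist P P' * real t \<le> 1"
  proof -
    have "1 * norm \<omega> \<le> of_int Q * norm \<omega>" using Q by (intro mult_right_mono) auto
    then have "(norm \<omega>)\<^sup>2 \<le> (of_int Q * norm \<omega>)\<^sup>2" by (intro power_mono) auto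
    then have "(norm \<omega>)\<^sup>2 \<le> of_int Q'" using Q'1 by linarith
    then have "(norm \<omega> * real t)\<^sup>2 \<le> (real_of_int Q')\<^sup>2"
      using tsq Q' unfolding power_mult_distrib power2_eq_square[of "real_of_int Q'"]
      by (intro mult_mono) auto
    then have "norm \<omega> * real t \<le> of_int Q'"
      by (rule power2_le_imp_le) (use Q' in simp)
    then show ?thesis using Q' by (simp add: dPP field_simps)
  qed
  have d\<kappa>: "dist P P' < \<kappa> / 4"
  proof -
    have "dist P P' * real t < \<kappa> / 4 * real t" using dle t\<kappa> by linarith
    then show ?thesis using mult_less_cancel_right_pos t10 by auto
  qed
  \<comment> \<open>The entries serve, in order: inclusion in the old ball; exclusion of
    \<open>x\<close> and \<open>near1\<close>; the hypothesis of
    \<open>reduced_frame_dist_ge\<close>; \<open>near2\<close>.\<close>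
  define \<rho>' where "\<rho>' = Min {\<rho> / 2, dist P P' / 10, 1 / (4 * sqrt (of_int Q')) / of_int Q',
      1 / 5 / (of_int Q' * (of_int Q * norm \<omega>))}"
  have \<rho>'0: "\<rho>' > 0" and \<rho>'1: "\<rho>' \<le> \<rho> / 2" and \<rho>'2: "\<rho>' \<le> dist P P' / 10"
    and \<rho>'3: "\<rho>' \<le> 1 / (4 * sqrt (of_int Q')) / of_int Q'"
    and \<rho>'4: "\<rho>' \<le> 1 / 5 / (of_int Q' * (of_int Q * norm \<omega>))"
    using \<rho> dpos Q Q' \<omega>0 by (auto simp: \<rho>'_def)
  have sub: "cball P' \<rho>' \<subseteq> cball P \<rho>"
  proof
    fix y assume "y \<in> cball P' \<rho>'"
    then show "y \<in> cball P \<rho>"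
      using dist_triangle[of P y P'] d\<kappa> \<kappa> \<rho>'1 by simp
  qed
  have notin: "x \<notin> cball P' \<rho>'"
  proof (cases "x = P")
    case True
    have "\<not> dist P P' \<le> \<rho>'" using \<rho>'2 dpos by linarith
    then show ?thesis using True by (simp add: dist_commute)
  next
    case False
    then have "\<not> dist x P' \<le> \<rho>'"
      using dist_triangle[of x P P'] dpos d\<kappa> \<kappa>(4) \<rho>'2
      unfolding dist_commute[of P' P] by linarith
    then show ?thesis by (simp add: dist_commute)
  qed
  have exc: "excursion Q Q' \<epsilon> \<theta>" if "\<theta> \<in> cball P' \<rho>'" for \<theta>
  proof -
    have n: "norm (\<theta> - P') \<le> \<rho>'" using that by (simp add: dist_norm norm_minus_commute)
    have n3: "of_int Q' * norm (\<theta> - P') \<le> 1 / (4 * sqrt (of_int Q'))"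
    proof -
      have "0 < real_of_int Q'" using Q' by simp
      then show ?thesis
        using order_trans[OF n \<rho>'3] by (simp only: pos_le_divide_eq mult.commute)
    qed
    have n2: "of_int Q' * norm (\<theta> - P') \<le> norm \<omega> / 10"
      using order_trans[OF n \<rho>'2] Q' by (simp add: dPP field_simps)
    have n4: "of_int Q' * norm (\<theta> - P') * (of_int Q * norm \<omega>) \<le> 1 / 5"
    proof -
      have "0 < of_int Q' * (of_int Q * norm \<omega>)" using Q Q' \<omega>0 by simp
      then have "norm (\<theta> - P') * (of_int Q' * (of_int Q * norm \<omega>)) \<le> 1 / 5"
        using order_trans[OF n \<rho>'4] by (simp only: pos_le_divide_eq)
      then show ?thesis by (simp add: ac_simps)
    qed
    have "dist_int (of_int Q *\<^sub>R \<theta>) \<le> norm (of_int Q *\<^sub>R \<theta> - of_int Q *\<^sub>R P)"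
      by (rule dist_int_le[OF Pi])
    also have "\<dots> = of_int Q * norm (\<theta> - P)" using Q by (simp flip: scaleR_diff_right)
    also have "\<dots> \<le> of_int Q * (2 * (norm \<omega> / of_int Q'))"
    proof (intro mult_left_mono)
      have "norm (\<theta> - P) \<le> \<rho>' + dist P P'"
        using n norm_triangle_ineq[of "\<theta> - P'" "P' - P"] by (simp add: dist_norm norm_minus_commute)
      also have "\<dots> \<le> 2 * dist P P'" using \<rho>'2 dpos by linarith
      finally show "norm (\<theta> - P) \<le> 2 * (norm \<omega> / of_int Q')" by (simp only: dPP)
    qed (use Q in simp)
    finally have "(dist_int (of_int Q *\<^sub>R \<theta>))\<^sup>2 \<le> (of_int Q * (2 * (norm \<omega> / of_int Q')))\<^sup>2"
      by (intro power_mono dist_int_nonneg)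
    also have "\<dots> = 4 * (of_int Q * norm \<omega>)\<^sup>2 / (of_int Q')\<^sup>2"
      by (simp add: power_mult_distrib power_divide)
    also have "\<dots> \<le> 4 * of_int Q' / (of_int Q')\<^sup>2"
      using Q'1 by (intro divide_right_mono mult_left_mono) auto
    also have "\<dots> = 4 / of_int Q'" by (simp add: power2_eq_square)
    finally have "of_int Q * (dist_int (of_int Q *\<^sub>R \<theta>))\<^sup>2 \<le> of_int Q * (4 / of_int Q')"
      using Q by (intro mult_left_mono) auto
    also have "\<dots> \<le> \<epsilon>"
    proof -
      have "2 * real t + 1 \<le> (2 * real t + 1)\<^sup>2" by (intro self_le_power) auto
      moreover have "\<kappa> * real t \<le> \<epsilon> * real t" using \<kappa>(3) by (intro mult_right_mono) auto
      ultimately have "16 \<le> \<epsilon> * (2 * real t + 1)\<^sup>2"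
        using t\<kappa> mult_left_mono[of "2 * real t + 1" "(2 * real t + 1)\<^sup>2" \<epsilon>] \<epsilon>
        by (simp add: algebra_simps)
      then have "of_int Q * 16 \<le> of_int Q * (\<epsilon> * (2 * real t + 1)\<^sup>2)"
        using Q by (intro mult_left_mono) auto
      also have "\<dots> = \<epsilon> * (of_int Q * (2 * real t + 1)\<^sup>2)" by simp
      also have "\<dots> \<le> \<epsilon> * (4 * of_int Q')" using Q'2 \<epsilon> by (intro mult_left_mono) auto
      finally show ?thesis using Q' by (simp add: field_simps)
    qed
    finally have 3: "of_int Q * (dist_int (of_int Q *\<^sub>R \<theta>))\<^sup>2 \<le> \<epsilon>" .
    show ?thesis
      unfolding excursion_def
      using reduced_frame_dist_ge[OF fr' n3[unfolded P'_def]]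
        reduced_frame_gap[OF fr t10 \<omega>_def Q'1 Q'44 n2[unfolded P'_def] n4[unfolded P'_def]] 3
      by blast
  qed
  have "reduced_denom Q' P'" using fr' by (auto simp: reduced_denom_def P'_def)
  moreover have "Q < Q'" using Q Q'44 by linarith
  ultimately show ?thesis using \<rho>'0 sub notin exc by blast
qed

text \<open>Cantor's diagonal argument: stage \<open>n\<close> discards \<open>x n\<close>, and
  compactness gives a point common to all the balls.\<close>

lemma exists_excursions:
  fixes x :: "nat \<Rightarrow> real ^ 2"
  obtains \<theta> and Q :: "nat \<Rightarrow> int"
  where "Q 0 = 1" "strict_mono Q" "\<theta> \<notin> range x"
    "\<And>n. excursion (Q n) (Q (Suc n)) (1 / (real n + 1)) \<theta>"
proof -
  \<comment> \<open>Dependent choice does not prescribe the initial state, so the start at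
    denominator 1 is put into the invariant.\<close>
  define I where "I = (\<lambda>n (Q, P, \<rho>). reduced_denom Q P \<and> \<rho> > (0::real) \<and> (n = (0::nat) \<longrightarrow> Q = 1))"
  define R where "R = (\<lambda>n (Q, P, \<rho>) (Q', P', \<rho>'). Q < Q' \<and> cball P' \<rho>' \<subseteq> cball P \<rho> \<and>
    x n \<notin> cball P' \<rho>' \<and> (\<forall>\<theta>\<in>cball P' \<rho>'. excursion Q Q' (1 / (real n + 1)) \<theta>))"
  have "\<exists>f. \<forall>n. I n (f n) \<and> R n (f n) (f (Suc n))"
  proof (rule dependent_nat_choice)
    show "\<exists>s. I 0 s"
      using reduced_frame_origin
      by (intro exI[of _ "(1, 0, 1)"]) (auto simp: I_def reduced_denom_def)
    show "\<exists>s'. I (Suc n) s' \<and> R n s s'" if "I n s" for n s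
    proof -
      obtain Q P \<rho> where s: "s = (Q, P, \<rho>)" by (cases s)
      have "reduced_denom Q P" "\<rho> > 0" using that by (auto simp: I_def s)
      from excursion_step[OF this, of "1 / (real n + 1)" "x n"]
      show ?thesis unfolding I_def R_def s by auto
    qed
  qed
  then obtain f where f: "\<And>n. I n (f n)" "\<And>n. R n (f n) (f (Suc n))" by blast
  define Q where "Q = (\<lambda>n. fst (f n))"
  define P where "P = (\<lambda>n. fst (snd (f n)))"
  define \<rho> where "\<rho> = (\<lambda>n. snd (snd (f n)))"
  have I: "\<rho> n > 0" "Q 0 = 1" for n
    using f(1)[of n] f(1)[of 0] by (auto simp: I_def Q_def P_def \<rho>_def split: prod.splits)
  have R: "Q n < Q (Suc n)" "cball (P (Suc n)) (\<rho> (Suc n)) \<subseteq> cball (P n) (\<rho> n)"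
    "x n \<notin> cball (P (Suc n)) (\<rho> (Suc n))"
    "\<forall>\<theta>\<in>cball (P (Suc n)) (\<rho> (Suc n)). excursion (Q n) (Q (Suc n)) (1 / (real n + 1)) \<theta>" for n
    using f(2)[of n] by (auto simp: R_def Q_def P_def \<rho>_def split: prod.splits)
  have "(\<Inter>n. cball (P n) (\<rho> n)) \<noteq> {}"
  proof (rule compact_nest)
    show "cball (P n) (\<rho> n) \<noteq> {}" for n using I(1)[of n] by simp
    show "cball (P n) (\<rho> n) \<subseteq> cball (P m) (\<rho> m)" if "m \<le> n" for m n
      using that R(2) by (rule lift_Suc_antimono_le[rotated])
  qed simp
  then obtain \<theta> where \<theta>: "\<And>n. \<theta> \<in> cball (P n) (\<rho> n)" by blast
  show ?thesis
  proof (rule that)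
    show "strict_mono Q" using R(1) by (simp add: strict_mono_Suc_iff)
    show "\<theta> \<notin> range x" using R(3) \<theta> by blast
    show "excursion (Q n) (Q (Suc n)) (1 / (real n + 1)) \<theta>" for n using R(4) \<theta> by blast
  qed (rule I)
qed

section \<open>From excursions to best approximations\<close>

text \<open>The least denominator with distance below \<open>c\<close> works, as all smaller ones
  have distance at least \<open>c\<close>.\<close>

lemma ex_best_approx_denom:
  assumes "1 \<le> u" "dist_int (real u *\<^sub>R \<theta>) < c"
  obtains v where "best_approx_denom \<theta> v" "v \<le> u" "dist_int (real v *\<^sub>R \<theta>) < c"
proof -
  let ?A = "\<lambda>v. 1 \<le> v \<and> dist_int (real v *\<^sub>R \<theta>) < c"
  define v where "v = (LEAST v. ?A v)"
  have "?A u" using assms by simp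
  then have v: "?A v" and "v \<le> u" unfolding v_def by (rule LeastI, rule Least_le)
  have "dist_int (real v *\<^sub>R \<theta>) < dist_int (real w *\<^sub>R \<theta>)" if "1 \<le> w" "w < v" for w
  proof -
    have "\<not> ?A w" using that(2) unfolding v_def by (rule not_less_Least)
    then show ?thesis using that(1) v by linarith
  qed
  then have "best_approx_denom \<theta> v" using v by (simp add: best_approx_denom_def)
  then show ?thesis using that v \<open>v \<le> u\<close> by blast
qed

text \<open>Infinitude is what makes \<open>enumerate\<close> a genuine increasing listing. A
  largest element \<open>N\<close> would be beaten by some best approximation denominator, which
  could be neither below nor above \<open>N\<close>.\<close>

lemma infinite_best_approx_denom:
  assumes "\<And>c. c > 0 \<Longrightarrow> \<exists>u\<ge>1. dist_int (real u *\<^sub>R \<theta>) < c"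
    and pos: "\<And>u::nat. 1 \<le> u \<Longrightarrow> 0 < dist_int (real u *\<^sub>R \<theta>)"
  shows "infinite {q. best_approx_denom \<theta> q}"
proof
  let ?S = "{q. best_approx_denom \<theta> q}"
  assume fin: "finite ?S"
  have "1 \<in> ?S" by (simp add: best_approx_denom_def)
  then obtain N where N: "N \<in> ?S" and Nmax: "\<And>q. q \<in> ?S \<Longrightarrow> q \<le> N"
    using fin by (metis Max_in Max_ge empty_iff)
  have M: "1 \<le> N" "\<And>u. 1 \<le> u \<Longrightarrow> u < N \<Longrightarrow> dist_int (real N *\<^sub>R \<theta>) < dist_int (real u *\<^sub>R \<theta>)"
    using N by (auto simp: best_approx_denom_def)
  obtain w where "w \<ge> 1" "dist_int (real w *\<^sub>R \<theta>) < dist_int (real N *\<^sub>R \<theta>)"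
    using assms(1) pos M(1) by blast
  then obtain u where "best_approx_denom \<theta> u" and u: "dist_int (real u *\<^sub>R \<theta>) < dist_int (real N *\<^sub>R \<theta>)"
    by (rule ex_best_approx_denom)
  moreover from this have "1 \<le> u" by (simp add: best_approx_denom_def)
  ultimately have "u \<le> N" by (intro Nmax) simp
  then consider "u = N" | "u < N" by linarith
  then show False using u \<open>1 \<le> u\<close> M(2)[of u] by cases auto
qed

lemma excursions_imp_Bad:
  fixes Q :: "nat \<Rightarrow> int"
  assumes Q0: "Q 0 = 1" and mono: "strict_mono Q"
    and exc: "\<And>n. excursion (Q n) (Q (Suc n)) (1 / (real n + 1)) \<theta>"
  shows "\<theta> \<in> Bad 1 - Bad 0"
proof -
  let ?d = "\<lambda>u::nat. dist_int (real u *\<^sub>R \<theta>)"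
  have Qge: "int n + 1 \<le> Q n" for n
  proof (induction n)
    case (Suc n)
    then show ?case using strict_monoD[OF mono, of n "Suc n"] by simp
  qed (simp add: Q0)
  define q where "q n = nat (Q n)" for n
  have q: "int (q n) = Q n" "real (q n) = of_int (Q n)" "n < q n" for n
    using Qge[of n] by (auto simp: q_def)
  have low: "1 / (4 * sqrt (real (q (Suc n)))) \<le> ?d u" if "1 \<le> u" "u < q (Suc n)" for n u
  proof -
    have "int u < Q (Suc n)" using that(2) q(1)[of "Suc n"] by linarith
    then show ?thesis using exc[of n] that(1) unfolding excursion_def by (simp add: q(2))
  qed
  have gap: "real (q (Suc n)) / 44 \<le> real u" if "1 \<le> u" "?d u < ?d (q n)" for n u
    using exc[of n] that unfolding excursion_def by (simp add: q(2))
  have small: "real (q n) * (?d (q n))\<^sup>2 \<le> 1 / (real n + 1)" for n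
    using exc[of n] unfolding excursion_def by (simp add: q(2))
  have pos: "0 < ?d u" if "1 \<le> u" for u
  proof -
    have "u < q (Suc u)" using q(3)[of "Suc u"] by simp
    from low[OF that this] show ?thesis
      using q(3)[of "Suc u"] by (intro less_le_trans[of 0 _ "?d u"]) auto
  qed
  have inf: "infinite {q. best_approx_denom \<theta> q}"
  proof (rule infinite_best_approx_denom)
    fix c :: real assume c: "c > 0"
    obtain n where n: "1 / c\<^sup>2 < real n" using reals_Archimedean2 by blast
    have "1 * (?d (q n))\<^sup>2 \<le> real (q n) * (?d (q n))\<^sup>2"
      using q(3)[of n] by (intro mult_right_mono) auto
    then have "(?d (q n))\<^sup>2 \<le> 1 / (real n + 1)" using small[of n] by linarith
    also have "\<dots> < c\<^sup>2"
    proof -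
      have "1 < c\<^sup>2 * real n" using n c by (simp add: field_simps)
      moreover have "c\<^sup>2 > 0" using c by simp
      ultimately have "1 < c\<^sup>2 * (real n + 1)" unfolding distrib_left mult_1_right by linarith
      then show ?thesis by (simp add: pos_divide_less_eq)
    qed
    finally have "?d (q n) < c" by (rule power2_less_imp_less) (use c in simp)
    then show "\<exists>u\<ge>1. ?d u < c" using q(3)[of n] by (intro exI[of _ "q n"]) auto
  qed (rule pos)
  let ?b = "best_denom \<theta>"
  have bmem: "best_approx_denom \<theta> (?b n)" for n
    using enumerate_in_set[OF inf] by (simp add: best_denom_def)
  have b1: "1 \<le> ?b n" for n using bmem by (auto simp: best_approx_denom_def)
  have bstep: "?b n < ?b (Suc n)" for n
    unfolding best_denom_def by (rule enumerate_step[OF inf])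
  have bdist: "best_dist \<theta> n = ?d (?b n)" for n by (simp add: best_dist_def)
  \<comment> \<open>Otherwise a best approximation denominator would lie strictly between two
    consecutive ones.\<close>
  have rle: "best_dist \<theta> n \<le> ?d u" if "1 \<le> u" "u < ?b (Suc n)" for n u
  proof (rule ccontr)
    assume neg: "\<not> ?thesis"
    then have "?d u < ?d (?b n)" using bdist by simp
    with \<open>1 \<le> u\<close> obtain v where v: "best_approx_denom \<theta> v" "v \<le> u" "?d v < ?d (?b n)"
      by (rule ex_best_approx_denom)
    have "\<not> v < ?b n"
      using v bmem[of n] unfolding best_approx_denom_def by (meson less_asym)
    then have "?b n < v" using v(3) by (metis less_irrefl linorder_neqE_nat)
    with v(1)
    have "?b (Suc n) \<le> v"
      unfolding best_denom_def enumerate_Suc'' [OF inf] by (intro Least_le) simp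
    then show False using v(2) that by simp
  qed
  have irr: "\<theta> \<notin> rat_points"
  proof
    assume "\<theta> \<in> rat_points"
    then have rat: "\<theta> $ 1 \<in> \<rat>" "\<theta> $ 2 \<in> \<rat>" by (auto simp: rat_points_def)
    have clear: "\<exists>n::nat. n \<noteq> 0 \<and> real n * y \<in> \<int>" if y: "y \<in> \<rat>" for y
    proof -
      obtain i :: int and n :: nat where "n \<noteq> 0" "y = of_int i / real n"
        using y by (auto simp: Rats_eq_int_div_nat)
      then have "real n * y = of_int i" by simp
      then show ?thesis using \<open>n \<noteq> 0\<close> Ints_of_int by metis
    qed
    obtain n1 n2 :: nat where n: "n1 \<noteq> 0" "real n1 * \<theta> $ 1 \<in> \<int>" "n2 \<noteq> 0" "real n2 * \<theta> $ 2 \<in> \<int>"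
      using clear[OF rat(1)] clear[OF rat(2)] by blast
    have "real n2 * (real n1 * \<theta> $ 1) \<in> \<int>" "real n1 * (real n2 * \<theta> $ 2) \<in> \<int>"
      by (rule Ints_mult[OF Ints_of_nat n(2)], rule Ints_mult[OF Ints_of_nat n(4)])
    then have "real (n1 * n2) *\<^sub>R \<theta> \<in> int_points"
      by (simp add: int_points_def forall_2 ac_simps)
    from dist_int_le[OF this, of "real (n1 * n2) *\<^sub>R \<theta>"] pos[of "n1 * n2"] n
    show False by simp
  qed
  \<comment> \<open>Choose \<open>j\<close> with \<open>q j \<le> ?b n < q (Suc j)\<close>. Then
    \<open>low\<close> bounds the distance at \<open>?b n\<close> from below. As
    \<open>?b (Suc n)\<close> improves on \<open>q j\<close>, \<open>gap\<close> makes it at least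
    \<open>q (Suc j) / 44\<close>. The constant is \<open>44 * 16 = 704\<close>.\<close>
  have "1 / 704 \<le> real (?b (n + 1)) * (best_dist \<theta> n)\<^sup>2" for n
  proof -
    let ?K = "\<lambda>k. ?b n < q k"
    have exK: "\<exists>k. ?K k" using q(3) by blast
    define k where "k = (LEAST k. ?K k)"
    have k: "?K k" unfolding k_def using exK by (rule LeastI_ex)
    have "k \<noteq> 0" using k b1[of n] Q0 by (intro notI) (simp add: q_def)
    then obtain j where j: "k = Suc j" using not0_implies_Suc by blast
    have "\<not> ?K j" using not_less_Least[of j ?K] j unfolding k_def[symmetric] by simp
    then have "q j < ?b (Suc n)" using bstep[of n] by simp
    then have "best_dist \<theta> n \<le> ?d (q j)" using q(3)[of j] by (intro rle) auto
    moreover have "?d (?b (Suc n)) < best_dist \<theta> n"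
      using bmem[of "Suc n"] bstep[of n] b1[of n] by (simp add: best_approx_denom_def bdist)
    ultimately have 1: "real (q k) / 44 \<le> real (?b (Suc n))"
      unfolding j using b1 by (intro gap) auto
    have "1 / (4 * sqrt (real (q k))) \<le> best_dist \<theta> n"
      unfolding bdist j using b1 k j by (intro low) auto
    then have "(1 / (4 * sqrt (real (q k))))\<^sup>2 \<le> (best_dist \<theta> n)\<^sup>2" by (intro power_mono) auto
    then have 2: "1 / (16 * real (q k)) \<le> (best_dist \<theta> n)\<^sup>2"
      by (simp add: power_divide power_mult_distrib)
    have "1 / 704 = real (q k) / 44 * (1 / (16 * real (q k)))" using k by simp
    also have "\<dots> \<le> real (?b (Suc n)) * (best_dist \<theta> n)\<^sup>2" using 1 2 by (intro mult_mono) auto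
    finally show ?thesis by simp
  qed
  then have "1 / 704 \<le> (INF n. real (?b (n + 1)) * (best_dist \<theta> n)\<^sup>2)"
    by (intro cINF_greatest) auto
  then have Bad1: "\<theta> \<in> Bad 1" using irr by (simp add: Bad_def)
  \<comment> \<open>Choose \<open>m\<close> with \<open>?b m \<le> q k < ?b (Suc m)\<close>; it
    exists because \<open>?b 0 = 1\<close>. By \<open>rle\<close> the product at \<open>m\<close> is
    at most the one at \<open>q k\<close>, which \<open>small\<close> controls.\<close>
  have "(INF n. real (?b (n + 0)) * (best_dist \<theta> n)\<^sup>2) \<le> 1 / (real k + 1)" for k
  proof -
    let ?N = "\<lambda>n. q k < ?b n"
    have exN: "\<exists>n. ?N n"
      using le_enumerate[OF inf, of "Suc (q k)"] unfolding best_denom_def Suc_le_eq by blast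
    define n where "n = (LEAST n. ?N n)"
    have n: "?N n" unfolding n_def using exN by (rule LeastI_ex)
    have "?b 0 = 1"
      unfolding best_denom_def enumerate_0
      by (intro Least_equality) (auto simp: best_approx_denom_def)
    then have "n \<noteq> 0" using n q(3)[of k] by (intro notI) simp
    then obtain m where m: "n = Suc m" using not0_implies_Suc by blast
    have "\<not> ?N m" using not_less_Least[of m ?N] m unfolding n_def[symmetric] by simp
    then have "real (?b m) \<le> real (q k)" by simp
    moreover have "best_dist \<theta> m \<le> ?d (q k)" using n m q(3)[of k] by (intro rle) auto
    then have "(best_dist \<theta> m)\<^sup>2 \<le> (?d (q k))\<^sup>2"
      by (intro power_mono) (simp_all add: bdist dist_int_nonneg)
    ultimately have "real (?b (m + 0)) * (best_dist \<theta> m)\<^sup>2 \<le> real (q k) * (?d (q k))\<^sup>2"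
      by (auto intro!: mult_mono)
    also have "\<dots> \<le> 1 / (real k + 1)" by (rule small)
    finally have "real (?b (m + 0)) * (best_dist \<theta> m)\<^sup>2 \<le> 1 / (real k + 1)" .
    moreover have "(INF n. real (?b (n + 0)) * (best_dist \<theta> n)\<^sup>2) \<le> real (?b (m + 0)) * (best_dist \<theta> m)\<^sup>2"
      by (intro cINF_lower bdd_belowI[of _ 0]) auto
    ultimately show ?thesis by linarith
  qed
  then have le: "(INF n. real (?b (n + 0)) * (best_dist \<theta> n)\<^sup>2) \<le> inverse (real (Suc k))" for k
    by (simp add: inverse_eq_divide add.commute)
  have "\<not> 0 < (INF n. real (?b (n + 0)) * (best_dist \<theta> n)\<^sup>2)"
  proof
    assume "0 < (INF n. real (?b (n + 0)) * (best_dist \<theta> n)\<^sup>2)"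
    from reals_Archimedean[OF this] show False using le leD by blast
  qed
  then have "\<theta> \<notin> Bad 0" by (simp add: Bad_def)
  then show ?thesis using Bad1 by simp
qed

theorem proposition9p1:
  shows "uncountable (Bad 1 - Bad 0)"
proof
  assume cnt: "countable (Bad 1 - Bad 0)"
  \<comment> \<open>The range of \<open>from_nat_into\<close> contains every countable set,
    including the empty one, so no separate case is required.\<close>
  obtain \<theta> and Q :: "nat \<Rightarrow> int" where Q: "Q 0 = 1" "strict_mono Q"
    and out: "\<theta> \<notin> range (from_nat_into (Bad 1 - Bad 0))"
    and exc: "\<And>n. excursion (Q n) (Q (Suc n)) (1 / (real n + 1)) \<theta>"
    using exists_excursions[where x = "from_nat_into (Bad 1 - Bad 0)"] by metis
  from excursions_imp_Bad[OF Q exc] have "\<theta> \<in> Bad 1 - Bad 0" .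
  with subset_range_from_nat_into[OF cnt] have "\<theta> \<in> range (from_nat_into (Bad 1 - Bad 0))"
    by (rule subsetD)
  with out show False by (rule notE)
qed

end
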